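(* Assume that $\mathcal G=(\mathcal V,\mathcal E)$ is strongly connected, $\{f_i\}_{i\in\mathcal V}\subset\mathcal F_L(\mathbb R^d)$, $r\in\mathcal F(\mathbb R^d)$, and that there exist $0<m<M<\infty$ such that $[\boldsymbol p_i^k]_l\ge m$, $m\le[\boldsymbol p_{i,j,1}^k]_l\le M$, and $|[\boldsymbol p_{i,j,2}^k]_l|\le M$ for all $k\ge0$, $1\le l\le d$, $i\in\mathcal V$ and $j\in\mathcal N(i)$, where $[\boldsymbol x]_l$ denotes the $l$-th coordinate of the vector $\boldsymbol x$. Suppose a sequence $\{\boldsymbol x_i^k,\boldsymbol y_i^k,\boldsymbol z_i^k\}_{i=1}^n$ generated by the updates $$\boldsymbol z_i^{k+1}=\mathrm{prox}_{r,\mathrm{Diag}(\boldsymbol p_i^k)}\big(\boldsymbol x_i^k-\boldsymbol p_i^k\odot(\nabla f_i(\boldsymbol x_i^k)+\boldsymbol y_i^k)\big),$$ $$\boldsymbol y_i^{k+1}=\boldsymbol y_i^k+\sum_{j\in\mathcal N(i)}\boldsymbol p_{i,j,1}^k\odot(\boldsymbol z_i^{k+1}-\boldsymbol z_j^{k+1}),$$ $$\boldsymbol x_i^{k+1}=\boldsymbol z_i^{k+1}-\sum_{j\in\mathcal N(i)}\boldsymbol p_{i,j,2}^k\odot(\boldsymbol z_i^{k+1}-\boldsymbol z_j^{k+1}),$$ for $i\in\mathcal V$, $k\ge0$, with initialization $\boldsymbol y_i^0=\boldsymbol 0_d$ for all $i\in\mathcal V$, converges to $\{\boldsymbol x_i^\star,\boldsymbol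 y_i^\star,\boldsymbol z_i^\star\}_{i=1}^n$ as $k\to\infty$. Then there exists $\boldsymbol x^\star\in\arg\min_{\boldsymbol x\in\mathbb R^d}f(\boldsymbol x)+r(\boldsymbol x)$ such that $\boldsymbol x_i^\star=\boldsymbol z_i^\star=\boldsymbol x^\star$ and $\boldsymbol y_i^\star\in-\nabla f_i(\boldsymbol x^\star)-\partial r(\boldsymbol x^\star)$ for all $i\in\mathcal V$.
   Context: Network: $\mathcal G=(\mathcal V,\mathcal E)$ is an undirected graph with $\mathcal V=\{1,\dots,n\}$, edges being unordered pairs $\{i,j\}$ with $i\ne j$; $\mathcal N(i)$ is the set of neighbors of node $i$. "Strongly connected" means that there is a path connecting any pair of nodes. Function families: $\mathcal F(\mathbb R^d)$ is the set of closed, proper, convex functions on $\mathbb R^d$; $\mathcal F_L(\mathbb R^d)$ is the set of convex, differentiable, $L$-smooth functions $\mathbb R^d\to\mathbb R$ (gradient $L$-Lipschitz). Here $f=\frac1n\sum_{i=1}^n f_i$, and $\partial r$ is the convex subdifferential of $r$. Parameters: $\boldsymbol p_i^k,\boldsymbol p_{i,j,1}^k,\boldsymbol p_{i,j,2}^k\in\mathbb R_+^d$ for $i\in\mathcal V$, $j\in\mathcal N(i)$, $k\ge 0$, and $\boldsymbol p_{i,j,1}^k=\boldsymbol p_{j,i,1}^k$ for all $\{i,j\}\in\mathcal E$. Notation: $\odot$ is the elementwise product, $\mathrm{Diag}(\boldsymbol p)$ is the diagonal matrix with diagonal $\boldsymbol p$, and $\boldsymbol 0_d$ is the zero vector in $\mathbb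 R^d$. For positive definite $\boldsymbol M$, $\|\boldsymbol x\|_{\boldsymbol M}:=\sqrt{\boldsymbol x^\top\boldsymbol M\boldsymbol x}$ and $\mathrm{prox}_{\phi,\boldsymbol M}(\boldsymbol x):=\arg\min_{\boldsymbol y}\phi(\boldsymbol y)+\frac12\|\boldsymbol y-\boldsymbol x\|_{\boldsymbol M^{-1}}^2$. *)

theory Defs
  imports
    "HOL-Analysis.Analysis"
    "Graph_Theory.Digraph_Component"
    "Graph_Theory.Pair_Digraph"
begin

text \<open>A graph on the nodes \<open>{1..n}\<close> is given by its set \<open>E\<close> of edges, each of which is an
  unordered pair. Reachability is that of the digraph with both orientations of every edge.\<close>

definition undirected_graph :: "nat \<Rightarrow> nat set set \<Rightarrow> bool" where
  "undirected_graph n E \<longleftrightarrow> E \<subseteq> {{i, j} | i j. i \<in> {1..n} \<and> j \<in> {1..n} \<and> i \<noteq> j}"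

definition neighbors :: "nat set set \<Rightarrow> nat \<Rightarrow> nat set" where
  "neighbors E i = {j. {i, j} \<in> E}"

definition digraph_of :: "nat \<Rightarrow> nat set set \<Rightarrow> (nat, nat \<times> nat) pre_digraph" where
  "digraph_of n E = with_proj \<lparr>pverts = {1..n}, parcs = {(i, j). {i, j} \<in> E}\<rparr>"


text \<open>Extended-real-valued convex functions. Closedness and convexity are those of the epigraph,
  which lies in the product of the space with the (finite) reals.\<close>

definition ereal_epigraph :: "('a \<Rightarrow> ereal) \<Rightarrow> ('a \<times> real) set" where
  "ereal_epigraph \<phi> = {(x, t). \<phi> x \<le> ereal t}"

definition closed_proper_convex :: "('a::euclidean_space \<Rightarrow> ereal) \<Rightarrow> bool" where
  "closed_proper_convex \<phi> \<longleftrightarrow>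
     closed (ereal_epigraph \<phi>) \<and>
     (\<forall>x. \<phi> x \<noteq> -\<infinity>) \<and> (\<exists>x. \<phi> x \<noteq> \<infinity>) \<and>
     convex (ereal_epigraph \<phi>)"

text \<open>If \<open>\<phi>\<close> is proper and \<open>\<phi> x = \<infinity>\<close>, the subdifferential at \<open>x\<close> is empty, as usual.\<close>

definition subdifferential :: "('a::euclidean_space \<Rightarrow> ereal) \<Rightarrow> 'a \<Rightarrow> 'a set" where
  "subdifferential \<phi> x = {g. \<forall>y. \<phi> x + ereal (g \<bullet> (y - x)) \<le> \<phi> y}"


definition gradient :: "('a::euclidean_space \<Rightarrow> real) \<Rightarrow> 'a \<Rightarrow> 'a" where
  "gradient f x = (THE D. GDERIV f x :> D)"

definition smooth_convex :: "real \<Rightarrow> ('a::euclidean_space \<Rightarrow> real) \<Rightarrow> bool" where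
  "smooth_convex L f \<longleftrightarrow>
     convex_on UNIV f \<and> f differentiable_on UNIV \<and> L-lipschitz_on UNIV (gradient f)"


definition Diag :: "real ^ 'd \<Rightarrow> real ^ 'd ^ 'd" where
  "Diag p = (\<chi> i j. if i = j then p $ i else 0)"

definition matrix_norm :: "real ^ 'd ^ 'd \<Rightarrow> real ^ 'd \<Rightarrow> real" where
  "matrix_norm A x = sqrt (x \<bullet> (A *v x))"

text \<open>Only meaningful if \<open>A\<close> is positive definite. The minimizer is then unique for closed
  proper convex \<open>\<phi>\<close>, so that the choice made by \<^const>\<open>arg_min\<close> is immaterial.\<close>

definition prox :: "(real ^ 'd \<Rightarrow> ereal) \<Rightarrow> real ^ 'd ^ 'd \<Rightarrow> real ^ 'd \<Rightarrow> real ^ 'd" where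
  "prox \<phi> A x =
     arg_min (\<lambda>y. \<phi> y + ereal (1 / 2 * (matrix_norm (matrix_inv A) (y - x))\<^sup>2)) (\<lambda>_. True)"

end

theory Submission
  imports Defs
begin

text \<open>
  The weights change with \<open>k\<close> and need not converge, so the updates have no limit equations. Their
  uniform bounds nevertheless force three facts about the limit, which together are the
  optimality conditions of the problem.

  \<^item> \<^emph>\<open>Consensus.\<close> Since \<open>y i\<close> converges, its increments, which are the values at \<open>i\<close> of the graph
    Laplacian with weights \<open>p1\<close> applied to \<open>z\<close>, tend to \<open>0\<close>. By symmetry of the weights, pairing
    the Laplacian with \<open>z\<close> gives an energy that dominates \<open>m * (norm (z i - z j))\<^sup>2\<close> for each edge.
    Hence the limits agree along edges, and by connectedness everywhere
    (\<open>vanishing_Laplacian_imp_neighbors_agree\<close>, \<open>strongly_connected_constant\<close>). The update of \<open>x\<close>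
    then gives \<open>x_lim i = z_lim i\<close>, because the weights \<open>p2\<close> are bounded.

  \<^item> \<^emph>\<open>Dual balance.\<close> The same symmetry makes the increments of \<open>y\<close> cancel in the sum over all
    nodes, so that the zero initialization yields \<open>(\<Sum>i\<in>{1..n}. y_lim i) = 0\<close>.

  \<^item> \<^emph>\<open>Stationarity.\<close> The optimality condition of the proximal step (\<open>prox_Diag_subgradient\<close>) says
    that \<open>(x i k - z i (Suc k)) / p i k - gradient (f i) (x i k) - y i k\<close>, with the division taken
    elementwise, is a subgradient of \<open>r\<close> at \<open>z i (Suc k)\<close>. The lower bound \<open>m\<close> on \<open>p\<close> makes the
    quotient vanish in the limit. As the graph of the subdifferential is
    closed (\<open>subdifferential_closed_graph\<close>), \<open>- gradient (f i) x_opt - y_lim i\<close> is a subgradient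
    of \<open>r\<close> at the common limit \<open>x_opt\<close>.

  Summing the last statement over \<open>i\<close> and using dual balance gives the first-order optimality
  condition for the average objective, which suffices by convexity
  (\<open>balanced_subgradients_imp_minimizer\<close>).

  The operator \<^const>\<open>prox\<close> picks an arbitrary point if there is no minimizer, so its optimality
  condition rests on an existence proof: an affine minorant of \<open>r\<close> makes the proximal objective
  coercive (\<open>closed_proper_convex_plus_coercive_attains_min\<close>).
\<close>

section \<open>Minimizing a closed proper convex function plus a coercive one\<close>

text \<open>A hyperplane that separates the epigraph from a point directly below it cannot be vertical.\<close>

lemma closed_proper_convex_affine_minorant:
  fixes \<phi> :: "'a::euclidean_space \<Rightarrow> ereal"
  assumes "closed_proper_convex \<phi>"
  obtains a b where "\<And>y t. \<phi> y \<le> ereal t \<Longrightarrow> a \<bullet> y + b \<le> t"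
proof -
  obtain x0 where x0: "\<phi> x0 \<noteq> \<infinity>" "\<phi> x0 \<noteq> -\<infinity>"
    using assms by (auto simp: closed_proper_convex_def)
  then obtain t0 where t0: "\<phi> x0 = ereal t0"
    by (cases "\<phi> x0") auto
  have "(x0, t0 - 1) \<notin> ereal_epigraph \<phi>"
    using t0 by (auto simp: ereal_epigraph_def)
  then obtain c d where below: "c \<bullet> (x0, t0 - 1) < d"
    and above: "\<And>w. w \<in> ereal_epigraph \<phi> \<Longrightarrow> d < c \<bullet> w"
    using separating_hyperplane_closed_point[of "ereal_epigraph \<phi>" "(x0, t0 - 1)"] assms
    unfolding closed_proper_convex_def by blast
  obtain g s where c: "c = (g, s)" by (cases c)
  have "(x0, t0) \<in> ereal_epigraph \<phi>"
    using t0 by (auto simp: ereal_epigraph_def)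
  from above[OF this] below have "s > 0"
    by (simp add: c inner_Pair algebra_simps)
  have "(- (1 / s) *\<^sub>R g) \<bullet> y + d / s \<le> t" if "\<phi> y \<le> ereal t" for y t
  proof -
    have "d < g \<bullet> y + s * t"
      using above[of "(y, t)"] that by (simp add: c inner_Pair ereal_epigraph_def)
    with \<open>s > 0\<close> show ?thesis by (simp add: field_simps)
  qed
  then show thesis by (rule that)
qed

text \<open>Working in the epigraph replaces the lower semicontinuous \<open>\<phi>\<close> by the continuous height
  coordinate. A sublevel set of \<open>(y, t) \<mapsto> t + q y\<close> in the epigraph is closed. It is bounded because
  the affine minorant of \<open>\<phi>\<close> can only decrease linearly, while \<open>q\<close> grows quadratically. So
  the minimum is attained by compactness.\<close>

lemma closed_proper_convex_plus_coercive_attains_min: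
  fixes \<phi> :: "'a::euclidean_space \<Rightarrow> ereal" and q :: "'a \<Rightarrow> real"
  assumes \<phi>: "closed_proper_convex \<phi>"
    and cont: "continuous_on UNIV q"
    and "c > 0" and growth: "\<And>y. c * (norm (y - v))\<^sup>2 \<le> q y"
  shows "\<exists>u. is_arg_min (\<lambda>y. \<phi> y + ereal (q y)) (\<lambda>_. True) u"
proof -
  obtain a b where minorant: "\<And>y t. \<phi> y \<le> ereal t \<Longrightarrow> a \<bullet> y + b \<le> t"
    using closed_proper_convex_affine_minorant[OF \<phi>] by blast
  obtain x0 where "\<phi> x0 \<noteq> \<infinity>" "\<phi> x0 \<noteq> -\<infinity>"
    using \<phi> by (auto simp: closed_proper_convex_def)
  then obtain t0 where t0: "\<phi> x0 = ereal t0"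
    by (cases "\<phi> x0") auto
  define C where "C = t0 + q x0"
  define K where "K = {w \<in> ereal_epigraph \<phi>. snd w + q (fst w) \<le> C}"
  \<comment> \<open>If \<open>\<rho> \<ge> 1\<close>, then dividing \<open>c * \<rho>\<^sup>2 \<le> norm a * \<rho> + \<bar>C - a \<bullet> v - b\<bar>\<close> by \<open>\<rho>\<close> bounds \<open>\<rho>\<close>
    by the second summand of \<open>R\<close>.\<close>
  define R where "R = 1 + (norm a + \<bar>C - a \<bullet> v - b\<bar>) / c"
  have cont': "continuous_on UNIV (\<lambda>w::'a \<times> real. snd w + q (fst w))"
    by (intro continuous_intros continuous_on_compose2[OF cont]) auto
  have "K = ereal_epigraph \<phi> \<inter> {w. snd w + q (fst w) \<le> C}"
    by (auto simp: K_def)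
  then have "closed K"
    using \<phi> cont' by (auto simp: closed_proper_convex_def intro!: closed_Int closed_Collect_le)
  have "K \<subseteq> cball v R \<times> {b - norm a * (norm v + R)..C}"
  proof
    fix w assume "w \<in> K"
    then obtain y t where w: "w = (y, t)" "\<phi> y \<le> ereal t" "t + q y \<le> C"
      by (cases w) (auto simp: K_def ereal_epigraph_def)
    define \<rho> where "\<rho> = norm (y - v)"
    have "\<rho> \<ge> 0" by (simp add: \<rho>_def)
    have "a \<bullet> (y - v) \<ge> - (norm a * \<rho>)"
      using Cauchy_Schwarz_ineq2[of a "y - v"] unfolding \<rho>_def by linarith
    then have quad: "c * \<rho>\<^sup>2 \<le> norm a * \<rho> + \<bar>C - a \<bullet> v - b\<bar>"
      using minorant[OF w(2)] w(3) growth[of y] by (simp add: \<rho>_def inner_diff_right)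
    have "\<rho> \<le> R"
    proof (cases "\<rho> \<le> 1")
      case True
      moreover have "0 \<le> (norm a + \<bar>C - a \<bullet> v - b\<bar>) / c" using \<open>c > 0\<close> by simp
      ultimately show ?thesis by (simp add: R_def)
    next
      case False
      have "\<bar>C - a \<bullet> v - b\<bar> * 1 \<le> \<bar>C - a \<bullet> v - b\<bar> * \<rho>"
        using False by (intro mult_left_mono) auto
      with quad have "(c * \<rho>) * \<rho> \<le> (norm a + \<bar>C - a \<bullet> v - b\<bar>) * \<rho>"
        by (simp add: power2_eq_square algebra_simps)
      with False have "c * \<rho> \<le> norm a + \<bar>C - a \<bullet> v - b\<bar>" by simp
      then have "\<rho> \<le> (norm a + \<bar>C - a \<bullet> v - b\<bar>) / c"
        using \<open>c > 0\<close> by (simp add: field_simps)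
      then show ?thesis by (simp add: R_def)
    qed
    have "norm y \<le> norm v + R"
      using norm_triangle_ineq[of v "y - v"] \<open>\<rho> \<le> R\<close> by (simp add: \<rho>_def)
    then have "norm a * norm y \<le> norm a * (norm v + R)"
      by (simp add: mult_left_mono)
    moreover have "a \<bullet> y \<ge> - (norm a * norm y)"
      using Cauchy_Schwarz_ineq2[of a y] by linarith
    ultimately have "b - norm a * (norm v + R) \<le> t"
      using minorant[OF w(2)] by linarith
    moreover have "t \<le> C"
      using w(3) growth[of y] \<open>c > 0\<close> by (smt (verit) mult_nonneg_nonneg zero_le_power2)
    ultimately show "w \<in> cball v R \<times> {b - norm a * (norm v + R)..C}"
      using \<open>\<rho> \<le> R\<close> by (simp add: w(1) \<rho>_def dist_norm norm_minus_commute)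
  qed
  then have "bounded K"
    by (rule bounded_subset[rotated]) (intro bounded_Times bounded_cball bounded_closed_interval)
  have mem: "(x0, t0) \<in> K"
    by (simp add: K_def ereal_epigraph_def C_def t0)
  have "compact K"
    using \<open>closed K\<close> \<open>bounded K\<close> compact_eq_bounded_closed by blast
  then obtain w where "w \<in> K" and w_min: "\<And>w'. w' \<in> K \<Longrightarrow> snd w + q (fst w) \<le> snd w' + q (fst w')"
    using continuous_attains_inf[of K "\<lambda>w. snd w + q (fst w)"] mem
      continuous_on_subset[OF cont' subset_UNIV] by blast
  then obtain u s where u: "w = (u, s)" "\<phi> u \<le> ereal s" and "s + q u \<le> C"
    by (cases w) (auto simp: K_def ereal_epigraph_def)
  have "\<phi> u + ereal (q u) \<le> \<phi> y + ereal (q y)" for y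
  proof (cases "\<phi> y")
    case (real t)
    have "s + q u \<le> t + q y"
    proof (cases "t + q y \<le> C")
      case True
      then have "(y, t) \<in> K" using real by (simp add: K_def ereal_epigraph_def)
      from w_min[OF this] show ?thesis by (simp add: u)
    qed (use \<open>s + q u \<le> C\<close> in linarith)
    moreover have "\<phi> u + ereal (q u) \<le> ereal (s + q u)"
      using add_right_mono[OF u(2), of "ereal (q u)"] by simp
    ultimately show ?thesis
      unfolding real plus_ereal.simps using order_trans ereal_less_eq(3) by blast
  next
    case MInf
    then show ?thesis using \<phi> by (auto simp: closed_proper_convex_def)
  qed simp
  then show ?thesis by (auto simp: is_arg_min_linorder)
qed

section \<open>Subgradients and gradients\<close>

text \<open>Fermat's rule for a sum. On the segment from \<open>u\<close> to \<open>y\<close>, the convex part increases by at most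
  \<open>\<theta> * (\<phi> y - \<phi> u)\<close>, so minimality bounds the difference quotient of \<open>q\<close> from below by
  \<open>\<phi> u - \<phi> y\<close>. As \<open>\<theta>\<close> tends to \<open>0\<close>, the quotient tends to \<open>D \<bullet> (y - u)\<close>. The proximal step
  uses this with a quadratic \<open>q\<close>, and the gradient inequality with a concave one.\<close>

lemma minimizer_plus_differentiable_subgradient:
  fixes \<phi> :: "'a::euclidean_space \<Rightarrow> ereal" and q :: "'a \<Rightarrow> real"
  assumes conv: "convex (ereal_epigraph \<phi>)"
    and proper: "\<And>y. \<phi> y \<noteq> -\<infinity>" "\<phi> u \<noteq> \<infinity>"
    and min: "is_arg_min (\<lambda>y. \<phi> y + ereal (q y)) (\<lambda>_. True) u"
    and grad: "GDERIV q u :> D"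
  shows "- D \<in> subdifferential \<phi> u"
proof -
  obtain s where s: "\<phi> u = ereal s"
    using proper by (metis ereal_cases)
  have "\<phi> u + ereal (- D \<bullet> (y - u)) \<le> \<phi> y" for y
  proof (cases "\<phi> y")
    case (real t)
    define h where "h \<theta> = q (u + \<theta> *\<^sub>R (y - u))" for \<theta>
    have "(h has_derivative (\<lambda>\<theta>. D \<bullet> (\<theta> *\<^sub>R (y - u)))) (at 0)"
      unfolding h_def
      by (rule has_derivative_compose[of "\<lambda>\<theta>. u + \<theta> *\<^sub>R (y - u)"])
         (use grad in \<open>auto simp: gderiv_def inner_commute intro!: derivative_eq_intros\<close>)
    then have "(h has_real_derivative (D \<bullet> (y - u))) (at 0)"
      by (simp add: has_field_derivative_def mult_commute_abs)
    then have "((\<lambda>\<theta>. (h \<theta> - h 0) / \<theta>) \<longlongrightarrow> D \<bullet> (y - u)) (at_right 0)"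
      by (auto simp: has_field_derivative_iff intro: filterlim_mono at_le)
    moreover have "\<forall>\<^sub>F \<theta> in at_right 0. s - t \<le> (h \<theta> - h 0) / \<theta>"
    proof (rule eventually_at_rightI[of 0 1])
      fix \<theta> :: real assume \<theta>: "\<theta> \<in> {0<..<1}"
      have "(1 - \<theta>) *\<^sub>R (u, s) + \<theta> *\<^sub>R (y, t) \<in> ereal_epigraph \<phi>"
        using \<theta> s real by (intro convexD[OF conv]) (auto simp: ereal_epigraph_def)
      also have "(1 - \<theta>) *\<^sub>R (u, s) + \<theta> *\<^sub>R (y, t) = (u + \<theta> *\<^sub>R (y - u), s + \<theta> * (t - s))"
        by (simp add: algebra_simps)
      finally have "\<phi> (u + \<theta> *\<^sub>R (y - u)) \<le> ereal (s + \<theta> * (t - s))"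
        by (simp add: ereal_epigraph_def)
      from add_right_mono[OF this, of "ereal (h \<theta>)"]
      have "\<phi> u + ereal (q u) \<le> ereal (s + \<theta> * (t - s)) + ereal (h \<theta>)"
        using min unfolding is_arg_min_linorder h_def by (metis order_trans)
      then have "\<theta> * (s - t) \<le> h \<theta> - h 0"
        by (simp add: s h_def algebra_simps)
      then show "s - t \<le> (h \<theta> - h 0) / \<theta>"
        using \<theta> by (simp add: field_simps)
    qed simp
    ultimately have "s - t \<le> D \<bullet> (y - u)"
      by (intro tendsto_lowerbound) auto
    then show ?thesis by (simp add: s real)
  qed (use proper in auto)
  then show ?thesis by (simp add: subdifferential_def)
qed

text \<open>The subgradient inequality at \<open>y\<close> says that \<open>(u k, \<phi> y - g k \<bullet> (y - u k))\<close> lies in the epigraph.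
  In this form it passes to the limit although \<open>\<phi>\<close> need not be continuous.\<close>

lemma subdifferential_closed_graph:
  fixes \<phi> :: "'a::euclidean_space \<Rightarrow> ereal"
  assumes closed: "closed (ereal_epigraph \<phi>)" and proper: "\<And>y. \<phi> y \<noteq> -\<infinity>"
    and sub: "\<And>k. g k \<in> subdifferential \<phi> (u k)"
    and lim: "u \<longlonglongrightarrow> u'" "g \<longlonglongrightarrow> g'"
  shows "g' \<in> subdifferential \<phi> u'"
proof -
  have "\<phi> u' + ereal (g' \<bullet> (y - u')) \<le> \<phi> y" for y
  proof (cases "\<phi> y")
    case (real t)
    have "(u k, t - g k \<bullet> (y - u k)) \<in> ereal_epigraph \<phi>" for k
    proof -
      have "\<phi> (u k) + ereal (g k \<bullet> (y - u k)) \<le> ereal t"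
        using sub[of k] unfolding subdifferential_def mem_Collect_eq real[symmetric] by (rule spec)
      then show ?thesis by (cases "\<phi> (u k)") (auto simp: ereal_epigraph_def)
    qed
    moreover have "(\<lambda>k. (u k, t - g k \<bullet> (y - u k))) \<longlonglongrightarrow> (u', t - g' \<bullet> (y - u'))"
      by (intro tendsto_intros lim)
    ultimately have "(u', t - g' \<bullet> (y - u')) \<in> ereal_epigraph \<phi>"
      by (rule closed_sequentially[OF closed])
    then show ?thesis
      using real by (cases "\<phi> u'") (auto simp: ereal_epigraph_def)
  qed (use proper in auto)
  then show ?thesis by (simp add: subdifferential_def)
qed

lemma subdifferential_finite:
  assumes "closed_proper_convex \<phi>" and "g \<in> subdifferential \<phi> u"
  shows "\<phi> u \<noteq> \<infinity>" "\<phi> u \<noteq> -\<infinity>"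
proof -
  obtain y where "\<phi> y \<noteq> \<infinity>"
    using assms(1) by (auto simp: closed_proper_convex_def)
  moreover have "\<phi> u + ereal (g \<bullet> (y - u)) \<le> \<phi> y"
    using assms(2) by (simp add: subdifferential_def)
  ultimately show "\<phi> u \<noteq> \<infinity>" by auto
qed (use assms in \<open>simp add: closed_proper_convex_def\<close>)

lemma GDERIV_gradient:
  assumes "f differentiable at x"
  shows "GDERIV f x :> gradient f x"
proof -
  obtain f' where f': "(f has_derivative f') (at x)"
    using assms by (auto simp: differentiable_def)
  have "GDERIV f x :> adjoint f' 1"
    using f' adjoint_works[OF has_derivative_linear[OF f'], of _ 1]
    by (simp add: gderiv_def inner_commute)
  moreover have "D = D'" if "GDERIV f x :> D" "GDERIV f x :> D'" for D D'
  proof -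
    have "(\<lambda>h. h \<bullet> D) = (\<lambda>h. h \<bullet> D')"
      using that unfolding gderiv_def by (rule has_derivative_unique)
    then show ?thesis by (metis vector_eq_ldot)
  qed
  ultimately have "\<exists>!D. GDERIV f x :> D" by blast
  then show ?thesis unfolding gradient_def by (rule theI')
qed

text \<open>Fermat's rule applies to \<open>f\<close> plus \<open>- f\<close>: every point minimizes the zero function.\<close>

lemma smooth_convex_gradient_inequality:
  assumes "smooth_convex L f"
  shows "f x + gradient f x \<bullet> (u - x) \<le> f u"
proof -
  have "ereal_epigraph (\<lambda>u. ereal (f u)) = epigraph UNIV f"
    by (auto simp: ereal_epigraph_def epigraph_def)
  then have "convex (ereal_epigraph (\<lambda>u. ereal (f u)))"
    using assms by (simp add: smooth_convex_def convex_epigraph)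
  moreover have "GDERIV (\<lambda>u. - f u) x :> - gradient f x"
    using assms by (intro GDERIV_minus GDERIV_gradient)
      (simp add: smooth_convex_def differentiable_on_def)
  moreover have "is_arg_min (\<lambda>u. ereal (f u) + ereal (- f u)) (\<lambda>_. True) x"
    by (simp add: is_arg_min_def)
  ultimately have "- (- gradient f x) \<in> subdifferential (\<lambda>u. ereal (f u)) x"
    by (intro minimizer_plus_differentiable_subgradient) auto
  then show ?thesis by (simp add: subdifferential_def)
qed

section \<open>The optimality condition of a diagonally scaled proximal step\<close>

lemma matrix_norm_inv_Diag:
  fixes p w :: "real ^ 'd"
  assumes "\<And>l. 0 < p $ l"
  shows "(matrix_norm (matrix_inv (Diag p)) w)\<^sup>2 = (\<Sum>l\<in>UNIV. (w $ l)\<^sup>2 / p $ l)"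
proof -
  define B where "B = Diag (\<chi> l. 1 / p $ l)"
  have p: "p $ l \<noteq> 0" for l using assms[of l] by simp
  have Diag_mult: "(Diag a ** Diag b) $ i $ j = (if i = j then a $ i * b $ i else 0)"
    for a b :: "real ^ 'd" and i j
  proof -
    have "(Diag a ** Diag b) $ i $ j =
        (\<Sum>k\<in>UNIV. if k = i then (if i = j then a $ i * b $ i else 0) else 0)"
      unfolding Diag_def matrix_matrix_mult_def vec_lambda_beta by (rule sum.cong) auto
    then show ?thesis by simp
  qed
  have "Diag p ** B = mat 1" "B ** Diag p = mat 1"
    using p by (simp_all add: vec_eq_iff B_def Diag_mult mat_def)
  then have "matrix_inv (Diag p) = B"
    unfolding matrix_inv_def
    by (intro some_equality conjI) (metis matrix_mul_assoc matrix_mul_lid matrix_mul_rid)+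
  moreover have "w \<bullet> (B *v w) = (\<Sum>l\<in>UNIV. (w $ l)\<^sup>2 / p $ l)"
  proof -
    have "(B *v w) $ l = (\<Sum>k\<in>UNIV. if k = l then w $ l / p $ l else 0)" for l
      unfolding B_def Diag_def matrix_vector_mult_def vec_lambda_beta by (rule sum.cong) auto
    then show ?thesis by (simp add: inner_vec_def power2_eq_square)
  qed
  moreover have "0 \<le> (\<Sum>l\<in>UNIV. (w $ l)\<^sup>2 / p $ l)"
    using assms by (intro sum_nonneg divide_nonneg_pos) auto
  ultimately show ?thesis by (simp add: matrix_norm_def)
qed

text \<open>This is Fermat's rule for the proximal objective: the subgradient is the negated gradient of its
  quadratic part, which is coercive because the entries of \<open>p\<close> have a finite maximum.\<close>

lemma prox_Diag_subgradient:
  fixes p v :: "real ^ 'd"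
  assumes \<phi>: "closed_proper_convex \<phi>" and p: "\<And>l. 0 < p $ l"
  shows "(\<chi> l. (v - prox \<phi> (Diag p) v) $ l / p $ l) \<in> subdifferential \<phi> (prox \<phi> (Diag p) v)"
proof -
  define q where "q y = 1 / 2 * (\<Sum>l\<in>UNIV. (y $ l - v $ l)\<^sup>2 / p $ l)" for y :: "real ^ 'd"
  define u where "u = prox \<phi> (Diag p) v"
  have u: "u = arg_min (\<lambda>y. \<phi> y + ereal (q y)) (\<lambda>_. True)"
    using matrix_norm_inv_Diag[OF p] by (simp add: u_def prox_def q_def)
  define P where "P = Max (range (($) p))"
  have P: "p $ l \<le> P" for l by (simp add: P_def)
  have "P > 0" using p P less_le_trans by blast
  have "1 / (2 * P) * (norm (y - v))\<^sup>2 \<le> q y" for y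
  proof -
    have "(y $ l - v $ l)\<^sup>2 / P \<le> (y $ l - v $ l)\<^sup>2 / p $ l" for l
      using p P \<open>P > 0\<close> by (intro divide_left_mono) auto
    then have "(\<Sum>l\<in>UNIV. (y $ l - v $ l)\<^sup>2 / P) \<le> (\<Sum>l\<in>UNIV. (y $ l - v $ l)\<^sup>2 / p $ l)"
      by (intro sum_mono)
    moreover
    have "(norm (y - v))\<^sup>2 = (\<Sum>l\<in>UNIV. (y $ l - v $ l)\<^sup>2)"
      unfolding power2_norm_eq_inner by (simp add: inner_vec_def power2_eq_square)
    then have "1 / (2 * P) * (norm (y - v))\<^sup>2 = 1 / 2 * (\<Sum>l\<in>UNIV. (y $ l - v $ l)\<^sup>2 / P)"
      by (simp add: sum_divide_distrib[symmetric])
    ultimately show ?thesis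
      unfolding q_def by linarith
  qed
  moreover have "continuous_on UNIV q"
    unfolding q_def using p by (intro continuous_intros) (auto simp: less_imp_neq[symmetric])
  ultimately have "\<exists>u. is_arg_min (\<lambda>y. \<phi> y + ereal (q y)) (\<lambda>_. True) u"
    using \<open>P > 0\<close>
    by (intro closed_proper_convex_plus_coercive_attains_min[OF \<phi>, where c = "1 / (2 * P)" and v = v])
      auto
  then have min: "is_arg_min (\<lambda>y. \<phi> y + ereal (q y)) (\<lambda>_. True) u"
    unfolding u arg_min_def by (rule someI_ex)
  obtain y where "\<phi> y \<noteq> \<infinity>"
    using \<phi> by (auto simp: closed_proper_convex_def)
  moreover have "\<phi> u + ereal (q u) \<le> \<phi> y + ereal (q y)"
    using min by (simp add: is_arg_min_linorder)
  ultimately have "\<phi> u \<noteq> \<infinity>" by auto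
  moreover have "GDERIV q u :> (\<chi> l. (u - v) $ l / p $ l)"
  proof -
    have "((\<lambda>y. (y $ l - v $ l)\<^sup>2 / p $ l) has_derivative
        (\<lambda>h. 2 * (h $ l * ((u $ l - v $ l) / p $ l)))) (at u)" for l
      using p[of l]
      by (auto intro!: derivative_eq_intros bounded_linear_imp_has_derivative[OF bounded_linear_vec_nth]
          simp: fun_eq_iff field_simps)
    then have "(q has_derivative (\<lambda>h. 1 / 2 * (\<Sum>l\<in>UNIV. 2 * (h $ l * ((u $ l - v $ l) / p $ l))))) (at u)"
      unfolding q_def by (intro has_derivative_mult_right has_derivative_sum)
    also have "(\<lambda>h. 1 / 2 * (\<Sum>l\<in>UNIV. 2 * (h $ l * ((u $ l - v $ l) / p $ l)))) =
        (\<lambda>h. h \<bullet> (\<chi> l. (u - v) $ l / p $ l))"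
      unfolding sum_distrib_left[symmetric] by (simp add: inner_vec_def)
    finally show ?thesis by (simp add: gderiv_def)
  qed
  ultimately have "- (\<chi> l. (u - v) $ l / p $ l) \<in> subdifferential \<phi> u"
    using \<phi> min by (intro minimizer_plus_differentiable_subgradient[where q = q])
      (auto simp: closed_proper_convex_def)
  moreover have "- (\<chi> l. (u - v) $ l / p $ l) = (\<chi> l. (v - u) $ l / p $ l)"
    by (simp add: vec_eq_iff diff_divide_distrib)
  ultimately show ?thesis by (simp add: u_def)
qed

section \<open>The weighted graph Laplacian\<close>

lemma neighbors_sym: "j \<in> neighbors E i \<longleftrightarrow> i \<in> neighbors E j"
  by (simp add: neighbors_def insert_commute)

lemma neighbors_subset:
  assumes "undirected_graph n E"
  shows "neighbors E i \<subseteq> {1..n}"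
  using assms by (fastforce simp: neighbors_def undirected_graph_def doubleton_eq_iff)

lemma sum_neighbors_swap:
  assumes "undirected_graph n E"
  shows "(\<Sum>i\<in>{1..n}. \<Sum>j\<in>neighbors E i. g i j) = (\<Sum>i\<in>{1..n}. \<Sum>j\<in>neighbors E i. g j i)"
proof -
  have sub: "j \<in> {1..n}" if "j \<in> neighbors E i" for i j
    using that neighbors_subset[OF assms] by blast
  have "(\<Sum>i\<in>{1..n}. \<Sum>j\<in>neighbors E i. g i j) =
      (\<Sum>i\<in>{1..n}. \<Sum>j | j \<in> {1..n} \<and> j \<in> neighbors E i. g i j)"
    by (intro sum.cong set_eqI refl) (auto dest: sub)
  also have "\<dots> = (\<Sum>j\<in>{1..n}. \<Sum>i | i \<in> {1..n} \<and> j \<in> neighbors E i. g i j)"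
    by (rule sum.swap_restrict) auto
  also have "\<dots> = (\<Sum>j\<in>{1..n}. \<Sum>i\<in>neighbors E j. g i j)"
    by (intro sum.cong set_eqI refl) (use sub neighbors_sym in blast)
  finally show ?thesis .
qed

lemma sum_neighbors_antisym:
  fixes g :: "nat \<Rightarrow> nat \<Rightarrow> 'a::real_vector"
  assumes "undirected_graph n E"
    and "\<And>i j. j \<in> neighbors E i \<Longrightarrow> g j i = - g i j"
  shows "(\<Sum>i\<in>{1..n}. \<Sum>j\<in>neighbors E i. g i j) = 0"
proof -
  have "(\<Sum>i\<in>{1..n}. \<Sum>j\<in>neighbors E i. g i j) = - (\<Sum>i\<in>{1..n}. \<Sum>j\<in>neighbors E i. g i j)"
    by (subst sum_neighbors_swap[OF assms(1)]) (simp add: assms(2) sum_negf)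
  then have "2 *\<^sub>R (\<Sum>i\<in>{1..n}. \<Sum>j\<in>neighbors E i. g i j) = 0"
    by (simp only: scaleR_2 eq_neg_iff_add_eq_0)
  then show ?thesis by simp
qed

text \<open>Summation by parts: the contributions of the two orientations of an edge to the left-hand side add
  up to its energy. Each energy occurs twice on the right-hand side, hence the factor.\<close>

lemma weighted_Laplacian_energy:
  fixes z :: "nat \<Rightarrow> real ^ 'd" and w :: "nat \<Rightarrow> nat \<Rightarrow> real ^ 'd"
  assumes "undirected_graph n E"
    and "\<And>i j. j \<in> neighbors E i \<Longrightarrow> w j i = w i j"
  shows "(\<Sum>i\<in>{1..n}. z i \<bullet> (\<Sum>j\<in>neighbors E i. w i j * (z i - z j))) =
    1 / 2 * (\<Sum>i\<in>{1..n}. \<Sum>j\<in>neighbors E i. (z i - z j) \<bullet> (w i j * (z i - z j)))"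
proof -
  define g where "g i j = z i \<bullet> (w i j * (z i - z j))" for i j
  have "g i j + g j i = (z i - z j) \<bullet> (w i j * (z i - z j))" if "j \<in> neighbors E i" for i j
    using assms(2)[OF that]
    by (simp add: g_def inner_vec_def algebra_simps flip: sum.distrib sum_subtractf)
  then have "(\<Sum>i\<in>{1..n}. \<Sum>j\<in>neighbors E i. (z i - z j) \<bullet> (w i j * (z i - z j))) =
      (\<Sum>i\<in>{1..n}. \<Sum>j\<in>neighbors E i. g i j) + (\<Sum>i\<in>{1..n}. \<Sum>j\<in>neighbors E i. g j i)"
    by (simp flip: sum.distrib)
  also have "\<dots> = 2 * (\<Sum>i\<in>{1..n}. \<Sum>j\<in>neighbors E i. g i j)"
    using sum_neighbors_swap[OF assms(1), of g] by simp
  finally show ?thesis by (simp add: g_def inner_sum_right)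
qed

lemma strongly_connected_constant:
  assumes "strongly_connected (digraph_of n E)"
    and "\<And>i j. j \<in> neighbors E i \<Longrightarrow> h i = h j"
    and "i \<in> {1..n}" "j \<in> {1..n}"
  shows "h i = h j"
proof -
  have "i \<rightarrow>\<^sup>*\<^bsub>digraph_of n E\<^esub> j"
    using assms by (auto simp: strongly_connected_def digraph_of_def)
  then have "(i, j) \<in> (arcs_ends (digraph_of n E))\<^sup>*"
    by (rule reachable_rtranclI)
  then show ?thesis
  proof (induction rule: rtrancl_induct)
    case (step v w)
    then have "w \<in> neighbors E v"
      by (auto simp: digraph_of_def neighbors_def arcs_ends_def arc_to_ends_def)
    with step.IH assms(2) show ?case by simp
  qed simp
qed

section \<open>Passing to the limit with bounded weights\<close>

lemma bounded_times_tendsto_zero: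
  fixes a u :: "nat \<Rightarrow> real ^ 'd"
  assumes "\<And>k l. \<bar>a k $ l\<bar> \<le> C" and "u \<longlonglongrightarrow> 0"
  shows "(\<lambda>k. a k * u k) \<longlonglongrightarrow> 0"
proof (rule vec_tendstoI)
  fix l
  have "(\<lambda>k. C * \<bar>u k $ l\<bar>) \<longlonglongrightarrow> C * \<bar>0 $ l\<bar>"
    by (intro tendsto_intros assms(2))
  moreover have "norm ((a k * u k) $ l) \<le> C * \<bar>u k $ l\<bar>" for k
    using assms(1) by (simp add: abs_mult mult_right_mono)
  ultimately show "(\<lambda>k. (a k * u k) $ l) \<longlonglongrightarrow> 0 $ l"
    by (simp add: Lim_null_comparison[where g = "\<lambda>k. C * \<bar>u k $ l\<bar>"])
qed

lemma weighted_energy_lower_bound: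
  fixes u w :: "real ^ 'd"
  assumes "\<And>l. m \<le> w $ l"
  shows "m * (norm u)\<^sup>2 \<le> u \<bullet> (w * u)"
proof -
  have "m * (u $ l)\<^sup>2 \<le> w $ l * (u $ l)\<^sup>2" for l
    using assms by (intro mult_right_mono) auto
  then have "(\<Sum>l\<in>UNIV. m * (u $ l)\<^sup>2) \<le> (\<Sum>l\<in>UNIV. w $ l * (u $ l)\<^sup>2)"
    by (rule sum_mono)
  then show ?thesis
    unfolding power2_norm_eq_inner
    by (simp add: inner_vec_def sum_distrib_left power2_eq_square mult_ac)
qed

text \<open>As \<open>z\<close> converges, its pairing with the Laplacian tends to \<open>0\<close>. This pairing is half the total
  energy and hence dominates half the energy of a single edge, in which the weight may be replaced
  by the constant \<open>m\<close>.\<close>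

lemma vanishing_Laplacian_imp_neighbors_agree:
  fixes z :: "nat \<Rightarrow> nat \<Rightarrow> real ^ 'd" and w :: "nat \<Rightarrow> nat \<Rightarrow> nat \<Rightarrow> real ^ 'd"
  assumes graph: "undirected_graph n E"
    and sym: "\<And>i j k. j \<in> neighbors E i \<Longrightarrow> w j i k = w i j k"
    and "0 < m"
    and bound: "\<And>i j k l. i \<in> {1..n} \<Longrightarrow> j \<in> neighbors E i \<Longrightarrow> m \<le> w i j k $ l"
    and z: "\<And>i. i \<in> {1..n} \<Longrightarrow> z i \<longlonglongrightarrow> z_lim i"
    and Lap: "\<And>i. i \<in> {1..n} \<Longrightarrow> (\<lambda>k. \<Sum>j\<in>neighbors E i. w i j k * (z i k - z j k)) \<longlonglongrightarrow> 0"
    and j: "j \<in> neighbors E i"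
  shows "z_lim i = z_lim j"
proof -
  have i_V: "i \<in> {1..n}" and j_V: "j \<in> {1..n}"
    using j neighbors_subset[OF graph] neighbors_sym by blast+
  have fin: "finite (neighbors E i)" for i
    using neighbors_subset[OF graph] finite_subset by blast
  define e where "e i j k = (z i k - z j k) \<bullet> (w i j k * (z i k - z j k))" for i j k
  have e_lower: "m * (norm (z i k - z j k))\<^sup>2 \<le> e i j k"
    if "i \<in> {1..n}" "j \<in> neighbors E i" for i j k
    unfolding e_def using bound that by (intro weighted_energy_lower_bound)
  have e_nonneg: "0 \<le> e i j k" if "i \<in> {1..n}" "j \<in> neighbors E i" for i j k
    using e_lower[OF that, of k] \<open>0 < m\<close> by (smt (verit) mult_nonneg_nonneg zero_le_power2)
  have energy: "m * (norm (z i k - z j k))\<^sup>2 \<le>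
      2 * (\<Sum>i\<in>{1..n}. z i k \<bullet> (\<Sum>j\<in>neighbors E i. w i j k * (z i k - z j k)))" for k
  proof -
    have "e i j k \<le> (\<Sum>j\<in>neighbors E i. e i j k)"
      using e_nonneg i_V by (intro member_le_sum[OF j]) (auto simp: fin)
    also have "\<dots> \<le> (\<Sum>i\<in>{1..n}. \<Sum>j\<in>neighbors E i. e i j k)"
      using e_nonneg by (intro member_le_sum[OF i_V] sum_nonneg) auto
    also have "\<dots> = 2 * (\<Sum>i\<in>{1..n}. z i k \<bullet> (\<Sum>j\<in>neighbors E i. w i j k * (z i k - z j k)))"
      unfolding e_def
      by (subst weighted_Laplacian_energy[OF graph, of "\<lambda>i j. w i j k" "\<lambda>i. z i k"]) (simp_all add: sym)
    finally show ?thesis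
      using e_lower[OF i_V j, of k] by linarith
  qed
  have lhs: "(\<lambda>k. m * (norm (z i k - z j k))\<^sup>2) \<longlonglongrightarrow> m * (norm (z_lim i - z_lim j))\<^sup>2"
    using z[OF i_V] z[OF j_V] by (intro tendsto_intros)
  have rhs: "(\<lambda>k. 2 * (\<Sum>i\<in>{1..n}. z i k \<bullet> (\<Sum>j\<in>neighbors E i. w i j k * (z i k - z j k))))
      \<longlonglongrightarrow> 2 * (\<Sum>i\<in>{1..n}. z_lim i \<bullet> 0)"
    using z Lap by (intro tendsto_intros)
  have "m * (norm (z_lim i - z_lim j))\<^sup>2 \<le> 2 * (\<Sum>i\<in>{1..n}. z_lim i \<bullet> 0)"
    by (rule LIMSEQ_le[OF lhs rhs]) (use energy in blast)
  then have "m * (norm (z_lim i - z_lim j))\<^sup>2 \<le> 0" by simp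
  then have "(norm (z_lim i - z_lim j))\<^sup>2 \<le> 0"
    using \<open>0 < m\<close> by (simp only: mult_le_0_iff) linarith
  then show ?thesis by simp
qed

section \<open>Optimality of the limit\<close>

text \<open>Adding the \<open>2 * n\<close> subgradient inequalities cancels all linear terms, which leaves \<open>n\<close> times
  the claim. Each node contributes its own subgradient of \<open>r\<close>, so the terms need not cancel node by
  node.\<close>

lemma balanced_subgradients_imp_minimizer:
  fixes f :: "nat \<Rightarrow> 'a::euclidean_space \<Rightarrow> real" and r :: "'a \<Rightarrow> ereal"
  assumes "n \<ge> 1" and r: "closed_proper_convex r"
    and f: "\<And>i u. i \<in> {1..n} \<Longrightarrow> f i u' + df i \<bullet> (u - u') \<le> f i u"
    and g: "\<And>i. i \<in> {1..n} \<Longrightarrow> g i \<in> subdifferential r u'"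
    and zero: "(\<Sum>i\<in>{1..n}. df i + g i) = 0"
  shows "is_arg_min (\<lambda>u. ereal (1 / real n * (\<Sum>i\<in>{1..n}. f i u)) + r u) (\<lambda>_. True) u'"
proof -
  have "r u' \<noteq> \<infinity>" "r u' \<noteq> -\<infinity>"
    using subdifferential_finite[OF r g[of 1]] \<open>n \<ge> 1\<close> by auto
  then obtain s where s: "r u' = ereal s" by (cases "r u'") auto
  have "ereal (1 / real n * (\<Sum>i\<in>{1..n}. f i u')) + r u' \<le> ereal (1 / real n * (\<Sum>i\<in>{1..n}. f i u)) + r u"
    for u
  proof (cases "r u")
    case (real t)
    have "f i u' + s + (df i + g i) \<bullet> (u - u') \<le> f i u + t" if "i \<in> {1..n}" for i
    proof -
      have "r u' + ereal (g i \<bullet> (u - u')) \<le> r u"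
        using g[OF that] by (simp add: subdifferential_def)
      then show ?thesis
        using f[OF that, of u] by (simp add: s real inner_add_left)
    qed
    then have "(\<Sum>i\<in>{1..n}. f i u' + s + (df i + g i) \<bullet> (u - u')) \<le> (\<Sum>i\<in>{1..n}. f i u + t)"
      by (rule sum_mono)
    then have "(\<Sum>i\<in>{1..n}. f i u') + real n * s \<le> (\<Sum>i\<in>{1..n}. f i u) + real n * t"
      using zero by (simp only: sum.distrib inner_sum_left[symmetric] sum_constant) simp
    then have "((\<Sum>i\<in>{1..n}. f i u') + real n * s) / real n \<le> ((\<Sum>i\<in>{1..n}. f i u) + real n * t) / real n"
      by (rule divide_right_mono) simp
    then have "1 / real n * (\<Sum>i\<in>{1..n}. f i u') + s \<le> 1 / real n * (\<Sum>i\<in>{1..n}. f i u) + t"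
      using \<open>n \<ge> 1\<close> by (simp add: add_divide_distrib)
    then show ?thesis by (simp add: s real)
  next
    case MInf
    then show ?thesis using r by (simp add: closed_proper_convex_def)
  qed simp
  then show ?thesis by (simp add: is_arg_min_linorder)
qed

theorem theorem2:
  fixes n :: nat and E :: "nat set set" and L m M :: real
    and f :: "nat \<Rightarrow> real ^ 'd \<Rightarrow> real"
    and r :: "real ^ 'd \<Rightarrow> ereal"
    and p :: "nat \<Rightarrow> nat \<Rightarrow> real ^ 'd"
    and p1 p2 :: "nat \<Rightarrow> nat \<Rightarrow> nat \<Rightarrow> real ^ 'd"
    and x y z :: "nat \<Rightarrow> nat \<Rightarrow> real ^ 'd"
    and x_lim y_lim z_lim :: "nat \<Rightarrow> real ^ 'd"
  assumes "n \<ge> 1"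
    and "undirected_graph n E"
    and "strongly_connected (digraph_of n E)"
    and "\<And>i. i \<in> {1..n} \<Longrightarrow> smooth_convex L (f i)"
    and "closed_proper_convex r"
    and "\<And>i k l. i \<in> {1..n} \<Longrightarrow> 0 \<le> p i k $ l"
    and "\<And>i j k l. i \<in> {1..n} \<Longrightarrow> j \<in> neighbors E i \<Longrightarrow> 0 \<le> p1 i j k $ l"
    and "\<And>i j k l. i \<in> {1..n} \<Longrightarrow> j \<in> neighbors E i \<Longrightarrow> 0 \<le> p2 i j k $ l"
    and "\<And>i j k. {i, j} \<in> E \<Longrightarrow> p1 i j k = p1 j i k"
    and "0 < m" and "m < M"
    and "\<And>i k l. i \<in> {1..n} \<Longrightarrow> m \<le> p i k $ l"
    and "\<And>i j k l. i \<in> {1..n} \<Longrightarrow> j \<in> neighbors E i \<Longrightarrow> m \<le> p1 i j k $ l \<and> p1 i j k $ l \<le> M"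
    and "\<And>i j k l. i \<in> {1..n} \<Longrightarrow> j \<in> neighbors E i \<Longrightarrow> \<bar>p2 i j k $ l\<bar> \<le> M"
    and "\<And>i k. i \<in> {1..n} \<Longrightarrow>
      z i (Suc k) = prox r (Diag (p i k)) (x i k - p i k * (gradient (f i) (x i k) + y i k))"
    and "\<And>i k. i \<in> {1..n} \<Longrightarrow>
      y i (Suc k) = y i k + (\<Sum>j\<in>neighbors E i. p1 i j k * (z i (Suc k) - z j (Suc k)))"
    and "\<And>i k. i \<in> {1..n} \<Longrightarrow>
      x i (Suc k) = z i (Suc k) - (\<Sum>j\<in>neighbors E i. p2 i j k * (z i (Suc k) - z j (Suc k)))"
    and "\<And>i. i \<in> {1..n} \<Longrightarrow> y i 0 = 0"
    and "\<And>i. i \<in> {1..n} \<Longrightarrow> x i \<longlonglongrightarrow> x_lim i"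
    and "\<And>i. i \<in> {1..n} \<Longrightarrow> y i \<longlonglongrightarrow> y_lim i"
    and "\<And>i. i \<in> {1..n} \<Longrightarrow> z i \<longlonglongrightarrow> z_lim i"
  shows "\<exists>x_opt.
    is_arg_min (\<lambda>u. ereal (1 / real n * (\<Sum>i\<in>{1..n}. f i u)) + r u) (\<lambda>_. True) x_opt \<and>
    (\<forall>i\<in>{1..n}. x_lim i = x_opt \<and> z_lim i = x_opt \<and>
       y_lim i \<in> {- gradient (f i) x_opt - g | g. g \<in> subdifferential r x_opt})"
proof -
  note graph = assms(2) and conn = assms(3) and smooth = assms(4) and r = assms(5)
  note p1_sym = assms(9) and m_pos = \<open>0 < m\<close>
  note p_lower = assms(12) and p1_bounds = assms(13) and p2_bound = assms(14)
  note z_step = assms(15) and y_step = assms(16) and x_step = assms(17) and y_init = assms(18)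
  note x_tendsto = assms(19) and y_tendsto = assms(20) and z_tendsto = assms(21)
  let ?V = "{1..n}"
  have nbr_V: "j \<in> ?V" if "j \<in> neighbors E i" for i j
    using that neighbors_subset[OF graph] by blast
  have p1_sym': "p1 j i k = p1 i j k" if "j \<in> neighbors E i" for i j k
    using p1_sym[of i j k] that by (simp add: neighbors_def)
  have z_Suc: "(\<lambda>k. z i (Suc k)) \<longlonglongrightarrow> z_lim i" if "i \<in> ?V" for i
    using z_tendsto[OF that] by (rule LIMSEQ_Suc)

  define xo where "xo = z_lim 1"
  have z_lim_nbr: "z_lim i = z_lim j" if "j \<in> neighbors E i" for i j
  proof (rule vanishing_Laplacian_imp_neighbors_agree[OF graph _ m_pos _ z_Suc _ that])
    fix i assume i: "i \<in> ?V"
    have "(\<lambda>k. y i (Suc k) - y i k) \<longlonglongrightarrow> y_lim i - y_lim i"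
      using y_tendsto[OF i] by (intro tendsto_diff LIMSEQ_Suc)
    then show "(\<lambda>k. \<Sum>j\<in>neighbors E i. p1 i j k * (z i (Suc k) - z j (Suc k))) \<longlonglongrightarrow> 0"
      using y_step[OF i] by simp
  qed (use p1_sym' p1_bounds in auto)
  have z_lim_eq: "z_lim i = xo" if "i \<in> ?V" for i
    unfolding xo_def by (rule strongly_connected_constant[OF conn z_lim_nbr that]) (use \<open>n \<ge> 1\<close> in simp_all)

  \<comment> \<open>The correction in the update of \<open>x\<close> consists of bounded multiples of differences that vanish
    by consensus.\<close>
  have x_lim_eq: "x_lim i = xo" if i: "i \<in> ?V" for i
  proof -
    have "(\<lambda>k. p2 i j k * (z i (Suc k) - z j (Suc k))) \<longlonglongrightarrow> 0" if j: "j \<in> neighbors E i" for j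
    proof (rule bounded_times_tendsto_zero[OF p2_bound[OF i j]])
      have "(\<lambda>k. z i (Suc k) - z j (Suc k)) \<longlonglongrightarrow> xo - xo"
        using z_Suc[OF i] z_Suc[OF nbr_V[OF j]] i nbr_V[OF j]
        by (intro tendsto_diff) (simp_all add: z_lim_eq)
      then show "(\<lambda>k. z i (Suc k) - z j (Suc k)) \<longlonglongrightarrow> 0" by simp
    qed
    then have "(\<lambda>k. x i (Suc k)) \<longlonglongrightarrow> z_lim i - (\<Sum>j\<in>neighbors E i. 0)"
      unfolding x_step[OF i] using z_Suc[OF i] by (intro tendsto_intros)
    moreover have "(\<lambda>k. x i (Suc k)) \<longlonglongrightarrow> x_lim i"
      using x_tendsto[OF i] by (rule LIMSEQ_Suc)
    ultimately show ?thesis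
      using LIMSEQ_unique z_lim_eq[OF i] by force
  qed

  have "(\<Sum>i\<in>?V. y i k) = 0" for k
  proof (induction k)
    case 0
    show ?case by (simp add: y_init)
  next
    case (Suc k)
    have "(\<Sum>i\<in>?V. \<Sum>j\<in>neighbors E i. p1 i j k * (z i (Suc k) - z j (Suc k))) = 0"
      by (rule sum_neighbors_antisym[OF graph]) (simp add: p1_sym' algebra_simps)
    with Suc show ?case by (simp add: y_step sum.distrib)
  qed
  moreover have "(\<lambda>k. \<Sum>i\<in>?V. y i k) \<longlonglongrightarrow> (\<Sum>i\<in>?V. y_lim i)"
    using y_tendsto by (intro tendsto_sum)
  ultimately have sum_y: "(\<Sum>i\<in>?V. y_lim i) = 0"
    by (simp add: LIMSEQ_const_iff)

  have sub: "- gradient (f i) xo - y_lim i \<in> subdifferential r xo" if i: "i \<in> ?V" for i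
  proof -
    \<comment> \<open>The subgradient at \<open>z i (Suc k)\<close> given by the proximal step, with the term that contains
      \<open>1 / p\<close> split off.\<close>
    define g where
      "g k = (\<chi> l. 1 / p i k $ l) * (x i k - z i (Suc k)) - (gradient (f i) (x i k) + y i k)" for k
    have p_pos: "0 < p i k $ l" for k l
      using p_lower[OF i, of k l] m_pos by linarith
    have g_sub: "g k \<in> subdifferential r (z i (Suc k))" for k
    proof -
      have "g k = (\<chi> l. (x i k - p i k * (gradient (f i) (x i k) + y i k) - z i (Suc k)) $ l / p i k $ l)"
        using p_pos[of k] by (simp add: g_def vec_eq_iff field_simps less_imp_neq[symmetric])
      then show ?thesis
        unfolding z_step[OF i] by (simp only: prox_Diag_subgradient[OF r p_pos])
    qed
    have z_xo: "(\<lambda>k. z i (Suc k)) \<longlonglongrightarrow> xo"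
      using z_Suc[OF i] z_lim_eq[OF i] by simp
    have g_tendsto: "g \<longlonglongrightarrow> 0 - (gradient (f i) xo + y_lim i)"
      unfolding g_def
    proof (intro tendsto_diff tendsto_add y_tendsto[OF i])
      have "x i \<longlonglongrightarrow> xo"
        using x_tendsto[OF i] x_lim_eq[OF i] by simp
      have "(\<lambda>k. x i k - z i (Suc k)) \<longlonglongrightarrow> xo - xo"
        using \<open>x i \<longlonglongrightarrow> xo\<close> z_xo by (rule tendsto_diff)
      then show "(\<lambda>k. (\<chi> l. 1 / p i k $ l) * (x i k - z i (Suc k))) \<longlonglongrightarrow> 0"
        using p_lower[OF i] p_pos m_pos
        by (intro bounded_times_tendsto_zero[where C = "1 / m"]) (auto simp: frac_le abs_of_pos)
      have "continuous_on UNIV (gradient (f i))"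
        using smooth[OF i] by (auto simp: smooth_convex_def intro: lipschitz_on_continuous_on)
      then show "(\<lambda>k. gradient (f i) (x i k)) \<longlonglongrightarrow> gradient (f i) xo"
        using \<open>x i \<longlonglongrightarrow> xo\<close> by (rule continuous_on_tendsto_compose) auto
    qed
    have "0 - (gradient (f i) xo + y_lim i) \<in> subdifferential r xo"
      by (rule subdifferential_closed_graph[OF _ _ g_sub z_xo g_tendsto])
        (use r in \<open>simp_all add: closed_proper_convex_def\<close>)
    then show ?thesis by simp
  qed

  have "is_arg_min (\<lambda>u. ereal (1 / real n * (\<Sum>i\<in>?V. f i u)) + r u) (\<lambda>_. True) xo"
  proof (rule balanced_subgradients_imp_minimizer[where df = "\<lambda>i. gradient (f i) xo",
        OF \<open>n \<ge> 1\<close> r _ sub])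
    show "f i xo + gradient (f i) xo \<bullet> (u - xo) \<le> f i u" if "i \<in> ?V" for i u
      using smooth[OF that] by (rule smooth_convex_gradient_inequality)
    show "(\<Sum>i\<in>?V. gradient (f i) xo + (- gradient (f i) xo - y_lim i)) = 0"
      using sum_y by (simp add: sum_negf)
  qed
  moreover have "y_lim i \<in> {- gradient (f i) xo - g | g. g \<in> subdifferential r xo}"
    if "i \<in> ?V" for i
    using sub[OF that] by force
  ultimately show ?thesis
    using x_lim_eq z_lim_eq by blast
qed

end
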